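(* For integers $s\ge1$ and $t\ge2$, \[ \begin{split} &\sum_{i = 1}^{t - 1} \binom {s+i-1}s\frac{2s + i - 1}{s + i - 1}\sum_{\mu = 1}^\infty \frac{H_{\mu ,t - i + 1} }{\mu ^{2s + i} } = \sum_{i = 1}^{t - 1} \binom {s+i-1}s\frac{2s + i - 1}{s + i - 1}\zeta (t - i + 1)\zeta (2s + i)\\ &\quad + ( - 1)^{s + 1} \sum_{i = 0}^{s - 1} ( - 1)^i \binom {t+i-1}{t-1}\frac{t + 2i - 1}{t + i - 1}\zeta (s - i + 1)\zeta (s + i + t) + \frac{1}{2}\frac{2s + t - 1}{s + t - 1}\binom {s+t-1}{t-1}\sum_{i = 1}^{2s + t - 2} \zeta (i + 1)\zeta (2s + t - i)\\ &\quad - \frac{1}{2}\frac{(2s + t - 1)(2s + t + 2)}{s + t - 1}\binom {s+t-1}{t-1}\zeta (2s + t + 1), \end{split} \] or, equivalently, \[ \begin{split} &\sum_{i = 2}^t \binom {s+t-i}s\frac{2s + t - i}{s + t - i}\sum_{\mu = 1}^\infty \frac{H_{\mu ,i} }{\mu ^{2s + t - i + 1} } = (-1)^{t-s}\sum_{i = t - s + 2}^{t + 1} (-1)^i\binom {2t-i}{t-1}\frac{3t - 2i + 1}{2t - i}\zeta (s - t + i)\zeta (s+2t-i+1)\\ &\quad + \sum_{i = 2}^t \binom {s+t-i}s\frac{2s + t - i}{s + t - i}\zeta (i)\zeta (2s + t -i + 1) + \frac{1}{2}\frac{2s + t - 1}{s + t - 1}\binom {s+t-1}{t-1}\sum_{i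 = 1}^{2s + t - 2} \zeta (i + 1)\zeta (2s + t - i)\\ &\quad - \frac{1}{2}\frac{(2s + t - 1)(2s + t + 2)}{s + t - 1}\binom {s+t-1}{t-1}\zeta (2s + t + 1). \end{split} \]
   Context: $H_{\mu,i}=\sum_{k=1}^\mu k^{-i}$ is a generalized harmonic number and $\zeta$ is the Riemann zeta function. *)

theory Defs
  imports Complex_Main
begin

definition gen_harm :: "nat \<Rightarrow> nat \<Rightarrow> real" where
  "gen_harm \<mu> i = (\<Sum>k=1..\<mu>. 1 / real k ^ i)"

(* The Riemann zeta function on the half-line x > 1, where it is given by its Dirichlet series;
   the value for x \<le> 1 is meaningless (no analytic continuation is performed). *)
definition zeta :: "real \<Rightarrow> real" where
  "zeta x = (\<Sum>n. 1 / real (Suc n) powr x)"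

(* The Euler sum of H(mu, p) / mu^q over mu \<ge> 1, with mu = Suc n.
   It converges for q \<ge> 2 (all p \<ge> 1). *)
definition euler_sum :: "nat \<Rightarrow> nat \<Rightarrow> real" where
  "euler_sum p q = (\<Sum>n. gen_harm (Suc n) p / real (Suc n) ^ q)"

end

theory Submission
  imports Defs "HOL-Analysis.Uniform_Limit"
begin

text \<open>
  For positive integers x = m and y = k consider (x - y) / ((x + y)^t (xy)^(s+1)). It is antisymmetric, so its
  double sum over all pairs is zero. Since x - y = x + (-y) and x = (x + y) + (-y), it is the sum of two
  products of the form 1 / (z^a w^b x^c) with z = x + y, w = -y and z + w = x, and expanding both in partial
  fractions in z and w adds up binomial coefficients to exactly the weights of the theorem. Powers of z
  produce the Euler sums, powers of w products of zeta values; the two simple poles are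
  only summable together, as 1/y - 1/(x + y), and give the linear Euler sum of H(mu, 1), which is eliminated
  by Euler's formula.
\<close>

text \<open>The positive integers summed over are written \<open>real (Suc n)\<close>; without this
  rule they stay atomic instead of becoming 1 + \<open>real n\<close>.\<close>

declare of_nat_Suc [simp del]
no_notation vector_scalar_mult (infixl "*s" 70)  (* it would capture the product 2*s *)

section \<open>Zeta values, their products, and absolute convergence over pairs\<close>

lemma zeta_sums:
  assumes "p \<ge> 2"
  shows "(\<lambda>n. 1 / real (Suc n) ^ p) sums zeta (real p)"
proof -
  have "summable (\<lambda>n. 1 / real n ^ p)"
    using inverse_power_summable[OF assms, where 'a = real] by (simp add: field_simps)
  then have "summable (\<lambda>n. 1 / real (Suc n) ^ p)"
    by (subst summable_Suc_iff)
  then show ?thesis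
    by (simp add: zeta_def powr_realpow summable_sums)
qed

lemma zeta_has_sum:
  assumes "p \<ge> 2"
  shows "((\<lambda>n. 1 / real (Suc n) ^ p) has_sum zeta (real p)) UNIV"
  by (rule sums_nonneg_imp_has_sum[OF zeta_sums[OF assms]]) simp

lemma zeta_mult_has_sum:
  assumes "p \<ge> 2" "q \<ge> 2"
  shows "((\<lambda>(m, k). 1 / (real (Suc m) ^ p * real (Suc k) ^ q)) has_sum
           zeta (real p) * zeta (real q)) (UNIV \<times> UNIV)"
proof -
  have g: "((\<lambda>m. 1 / real (Suc m) ^ p * zeta (real q)) has_sum zeta (real p) * zeta (real q)) UNIV"
    by (intro has_sum_cmult_left zeta_has_sum assms)
  have f: "((\<lambda>k. case (m, k) of (m, k) \<Rightarrow> 1 / (real (Suc m) ^ p * real (Suc k) ^ q)) has_sum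
          1 / real (Suc m) ^ p * zeta (real q)) UNIV" for m
    using has_sum_cmult_right[OF zeta_has_sum[OF assms(2)], of "1 / real (Suc m) ^ p"] by simp
  show ?thesis
    \<comment> \<open>Joint summability over the pairs follows from nonnegative terms and summable
      inner sums.\<close>
    by (rule has_sum_SigmaI[OF f g], rule summable_on_SigmaI[OF f])
       (use g in \<open>auto simp: summable_on_def\<close>)
qed

text \<open>Comparison with 1 / (x^2 y^2), whose sum over all pairs is \<zeta>(2)^2. This one
  majorant serves every mixed double series below.\<close>

lemma summable_on_by_double_zeta:
  fixes f :: "nat \<times> nat \<Rightarrow> real"
  assumes "\<And>m k. \<bar>f (m, k)\<bar> \<le> 1 / (real (Suc m) ^ 2 * real (Suc k) ^ 2)"
  shows "f summable_on (UNIV \<times> UNIV)"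
proof -
  have "(\<lambda>x. norm (f x)) summable_on (UNIV \<times> UNIV)"
    by (rule summable_on_comparison_test[OF has_sum_imp_summable[OF zeta_mult_has_sum[of 2 2]]])
       (use assms in auto)
  then show ?thesis
    by (rule abs_summable_summable)
qed

text \<open>Fubini: given joint summability, knowing the inner sums is enough, and the outer series
  converges without further argument.\<close>

lemma has_sum_iterated:
  fixes f :: "nat \<times> nat \<Rightarrow> real"
  assumes "f summable_on (UNIV \<times> UNIV)" "\<And>m. ((\<lambda>k. f (m, k)) has_sum g m) UNIV"
  shows "summable g" "(f has_sum suminf g) (UNIV \<times> UNIV)"
proof -
  obtain S where S: "(f has_sum S) (UNIV \<times> UNIV)"
    using assms(1) by (auto simp: summable_on_def)
  have "g sums S"
    by (rule has_sum_imp_sums, rule has_sum_SigmaD[OF S]) (rule assms(2))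
  then show "summable g" "(f has_sum suminf g) (UNIV \<times> UNIV)"
    using S by (auto simp: sums_iff)
qed

section \<open>Double zeta values, summed in two orders\<close>

text \<open>With x = \<open>Suc m\<close>, y = \<open>Suc k\<close> and n = x + y, these are the
  terms 1 / (n^p x^q), n > x, of the double zeta value \<zeta>(p, q). Indexing by (m, k) makes the
  exchange of x and y a swap of coordinates.\<close>

definition dz_term :: "nat \<Rightarrow> nat \<Rightarrow> nat \<times> nat \<Rightarrow> real" where
  "dz_term p q = (\<lambda>(m, k). 1 / ((real (Suc m) + real (Suc k)) ^ p * real (Suc m) ^ q))"

text \<open>If q \<ge> 2, two factors x + y dominate y^2 and x^q dominates x^2. If q = 1, a third
  factor x + y, available because then p \<ge> 3, supplies the missing x.\<close>

lemma dz_term_summable: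
  assumes "p \<ge> 2" "q \<ge> 1" "p + q \<ge> 4"
  shows "dz_term p q summable_on (UNIV \<times> UNIV)"
proof (rule summable_on_by_double_zeta)
  fix m k
  define x y where "x = real (Suc m)" and "y = real (Suc k)"
  have x: "x \<ge> 1" and y: "y \<ge> 1" by (auto simp: x_def y_def)
  have "x ^ 2 * y ^ 2 \<le> (x + y) ^ p * x ^ q"
  proof (cases "q = 1")
    case True
    then have "p \<ge> 3" using assms by simp
    have "x * y ^ 2 \<le> (x + y) * (x + y) ^ 2"
      using x y by (intro mult_mono power_mono) auto
    also have "\<dots> = (x + y) ^ 3" by (simp add: power3_eq_cube power2_eq_square)
    also have "\<dots> \<le> (x + y) ^ p"
      using \<open>p \<ge> 3\<close> x y by (intro power_increasing) auto
    finally have "x * (x * y ^ 2) \<le> x * (x + y) ^ p" using x by (intro mult_left_mono) auto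
    then show ?thesis using True by (simp add: power2_eq_square mult_ac)
  next
    case False
    have "y ^ 2 \<le> (x + y) ^ 2" using x y by (intro power_mono) auto
    also have "\<dots> \<le> (x + y) ^ p" using assms x y by (intro power_increasing) auto
    finally have "y ^ 2 * x ^ 2 \<le> (x + y) ^ p * x ^ q"
      using False assms x y by (intro mult_mono power_increasing) auto
    then show ?thesis by (simp add: mult_ac)
  qed
  then have "1 / ((x + y) ^ p * x ^ q) \<le> 1 / (x ^ 2 * y ^ 2)"
    using x y by (intro divide_left_mono mult_pos_pos zero_less_power) auto
  then show "\<bar>dz_term p q (m, k)\<bar> \<le> 1 / (real (Suc m) ^ 2 * real (Suc k) ^ 2)"
    using x y by (simp add: dz_term_def flip: x_def y_def)
qed

lemma gen_harm_eq_lessThan: "gen_harm n p = (\<Sum>i<n. 1 / real (Suc i) ^ p)"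
  unfolding gen_harm_def by (rule sum.reindex_bij_witness[of _ Suc "\<lambda>i. i - 1"]) auto

lemma gen_harm_Suc: "gen_harm (Suc n) p = gen_harm n p + 1 / real (Suc n) ^ p"
  by (simp add: gen_harm_eq_lessThan)

text \<open>Summing over y first, for fixed x, gives the zeta tail \<zeta>(p) - H(x, p); dividing by
  x^q and summing over x gives the value.\<close>

lemma dz_term_has_sum_product:
  assumes "p \<ge> 2" "q \<ge> 2"
  shows "(dz_term p q has_sum zeta (real p) * zeta (real q) - euler_sum p q) (UNIV \<times> UNIV)"
proof -
  let ?g = "\<lambda>m. 1 / real (Suc m) ^ q * (zeta (real p) - gen_harm (Suc m) p)"
  have inner: "((\<lambda>k. dz_term p q (m, k)) has_sum ?g m) UNIV" for m
  proof -
    have "(\<lambda>k. 1 / real (Suc (k + Suc m)) ^ p) sums (zeta (real p) - gen_harm (Suc m) p)"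
      unfolding gen_harm_eq_lessThan
      by (rule sums_split_initial_segment[OF zeta_sums[OF assms(1)]])
    then have "((\<lambda>k. 1 / real (Suc (k + Suc m)) ^ p) has_sum (zeta (real p) - gen_harm (Suc m) p)) UNIV"
      by (rule sums_nonneg_imp_has_sum) simp
    from has_sum_cmult_right[OF this, of "1 / real (Suc m) ^ q"] show ?thesis
      by (simp add: dz_term_def of_nat_Suc add_ac mult_ac)
  qed
  note it = has_sum_iterated[OF dz_term_summable inner]
  have g: "summable ?g" "(dz_term p q has_sum suminf ?g) (UNIV \<times> UNIV)"
    using it assms by auto
  have z: "(\<lambda>m. 1 / real (Suc m) ^ q * zeta (real p)) sums (zeta (real q) * zeta (real p))"
    by (rule sums_mult2[OF zeta_sums[OF assms(2)]])
  \<comment> \<open>Subtracting the tails from the full product leaves exactly the terms of the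
    Euler sum, whose convergence is thereby obtained too.\<close>
  have "(\<lambda>m. 1 / real (Suc m) ^ q * zeta (real p) - ?g m) sums (zeta (real q) * zeta (real p) - suminf ?g)"
    by (rule sums_diff[OF z summable_sums[OF g(1)]])
  also have "(\<lambda>m. 1 / real (Suc m) ^ q * zeta (real p) - ?g m)
             = (\<lambda>m. gen_harm (Suc m) p / real (Suc m) ^ q)"
    by (auto simp: field_simps)
  finally have "euler_sum p q = zeta (real q) * zeta (real p) - suminf ?g"
    by (simp add: euler_sum_def sums_iff)
  then show ?thesis using g(2) by (simp add: mult.commute)
qed

text \<open>Summing over x first, for fixed n = x + y, gives H(n - 1, q) / n^p. Replacing H(n - 1,
  q) by H(n, q) costs \<zeta>(p + q). Unlike the other order of summation, this one also covers q =
  1.\<close>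

lemma dz_term_has_sum_swap:
  assumes "p \<ge> 2" "q \<ge> 1" "p + q \<ge> 4"
  shows "(dz_term p q has_sum euler_sum q p - zeta (real (p + q))) (UNIV \<times> UNIV)"
proof -
  let ?h = "\<lambda>n. gen_harm (Suc n) q / real (Suc (Suc n)) ^ p"
  obtain S where S: "(dz_term p q has_sum S) (UNIV \<times> UNIV)"
    using dz_term_summable[OF assms] by (auto simp: summable_on_def)
  \<comment> \<open>The pairs are grouped by n = m + k, so x + y is \<open>Suc (Suc n)\<close> and m
    runs through 0, ..., n.\<close>
  have "((\<lambda>(n, m). 1 / (real (Suc (Suc n)) ^ p * real (Suc m) ^ q)) has_sum S) (SIGMA n:UNIV. {..n})"
    using S
    by (subst has_sum_reindex_bij_witness[where T = "UNIV \<times> UNIV" and h = "dz_term p q" and s' = S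
          and j = "\<lambda>(n, m). (m, n - m)" and i = "\<lambda>(m, k). (m + k, m)"])
       (auto simp: dz_term_def of_nat_Suc of_nat_diff algebra_simps)
  moreover have "((\<lambda>m. case (n, m) of (n, m) \<Rightarrow> 1 / (real (Suc (Suc n)) ^ p * real (Suc m) ^ q))
                   has_sum ?h n) {..n}" for n
    by (rule has_sum_finiteI)
       (auto simp: gen_harm_eq_lessThan lessThan_Suc_atMost sum_divide_distrib mult_ac)
  ultimately have "(?h has_sum S) UNIV"
    by (rule has_sum_SigmaD)
  then have "?h sums S" by (rule has_sum_imp_sums)
  \<comment> \<open>The term prepended by this shift is zero, since \<open>gen_harm 0 q\<close> is
    an empty sum.\<close>
  then have "(\<lambda>n. gen_harm n q / real (Suc n) ^ p) sums S"
    by (subst (asm) sums_Suc_iff) (simp add: gen_harm_def)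
  from sums_add[OF this zeta_sums[of "p + q"]] assms
  have "(\<lambda>n. gen_harm (Suc n) q / real (Suc n) ^ p) sums (S + zeta (real (p + q)))"
    by (simp add: gen_harm_Suc add_divide_distrib power_add mult_ac)
  then have "euler_sum q p = S + zeta (real (p + q))"
    by (simp add: euler_sum_def sums_iff)
  then show ?thesis using S by simp
qed

section \<open>Euler's formula for the linear Euler sums\<close>

text \<open>Raising the shift from n to n + 1 adds a telescoping series with sum
  \<open>a n\<close>.\<close>

lemma shifted_difference_sums:
  fixes a :: "nat \<Rightarrow> real"
  assumes "a \<longlonglongrightarrow> 0"
  shows "(\<lambda>k. a k - a (k + n)) sums (\<Sum>i<n. a i)"
proof (induction n)
  case (Suc n)
  have "(\<lambda>k. a (k + n)) \<longlonglongrightarrow> 0" using assms by (rule LIMSEQ_ignore_initial_segment)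
  from sums_add[OF Suc telescope_sums'[OF this]] show ?case by simp
qed simp

lemma has_sum_finite_sum:
  fixes f :: "'i \<Rightarrow> 'b \<Rightarrow> 'a :: topological_comm_monoid_add"
  assumes "\<And>i. i \<in> I \<Longrightarrow> (f i has_sum S i) A"
  shows "((\<lambda>x. \<Sum>i\<in>I. f i x) has_sum (\<Sum>i\<in>I. S i)) A"
  using assms by (induction I rule: infinite_finite_induct) (auto intro: has_sum_add)

lemma has_sum_diff:
  fixes f g :: "'b \<Rightarrow> real"
  assumes "(f has_sum S) A" "(g has_sum T) A"
  shows "((\<lambda>x. f x - g x) has_sum (S - T)) A"
  using has_sum_add[OF assms(1) has_sum_uminusI[OF assms(2)]] by simp

text \<open>For fixed x the differences 1/y - 1/(x + y) sum over y to H(x, 1). They equal x / (y (x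
  + y)), which uses up one power of x; q \<ge> 3 leaves the two that the majorant needs.\<close>

lemma harmonic_tail_has_sum:
  assumes "q \<ge> 3"
  shows "((\<lambda>(m, k). 1 / real (Suc m) ^ q * (1 / real (Suc k) - 1 / (real (Suc m) + real (Suc k))))
           has_sum euler_sum 1 q) (UNIV \<times> UNIV)"
proof -
  let ?f = "\<lambda>(m, k). 1 / real (Suc m) ^ q * (1 / real (Suc k) - 1 / (real (Suc m) + real (Suc k)))"
  have "?f summable_on (UNIV \<times> UNIV)"
  proof (rule summable_on_by_double_zeta)
    fix m k
    define x y where "x = real (Suc m)" and "y = real (Suc k)"
    have x: "x \<ge> 1" and y: "y \<ge> 1" by (auto simp: x_def y_def)
    have "\<bar>1 / x ^ q * (1 / y - 1 / (x + y))\<bar> = 1 / x ^ (q - 1) * (1 / (y * (x + y)))"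
    proof -
      obtain r where "q = Suc r" using assms by (cases q) auto
      then have "1 / x ^ q * (1 / y - 1 / (x + y)) = 1 / x ^ (q - 1) * (1 / (y * (x + y)))"
        using x y by (simp add: field_simps)
      then show ?thesis using x y by simp
    qed
    also have "\<dots> \<le> 1 / x ^ 2 * (1 / y ^ 2)"
    proof (rule mult_mono)
      show "1 / x ^ (q - 1) \<le> 1 / x ^ 2"
        using x assms by (intro divide_left_mono power_increasing) auto
      show "1 / (y * (x + y)) \<le> 1 / y ^ 2"
        using x y by (intro divide_left_mono) (auto simp: power2_eq_square)
    qed (use x y in auto)
    finally show "\<bar>?f (m, k)\<bar> \<le> 1 / (real (Suc m) ^ 2 * real (Suc k) ^ 2)"
      by (simp add: x_def y_def)
  qed
  moreover have "((\<lambda>k. ?f (m, k)) has_sum gen_harm (Suc m) 1 / real (Suc m) ^ q) UNIV" for m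
  proof -
    have "(\<lambda>k. 1 / real (Suc k)) \<longlonglongrightarrow> 0"
      using LIMSEQ_inverse_real_of_nat by (simp add: divide_inverse)
    from shifted_difference_sums[OF this, of "Suc m"]
    have "(\<lambda>k. 1 / real (Suc k) - 1 / (real (Suc m) + real (Suc k))) sums gen_harm (Suc m) 1"
      by (simp add: gen_harm_eq_lessThan of_nat_Suc add_ac)
    then have "((\<lambda>k. 1 / real (Suc k) - 1 / (real (Suc m) + real (Suc k))) has_sum gen_harm (Suc m) 1) UNIV"
      by (rule sums_nonneg_imp_has_sum) (auto simp: field_simps)
    from has_sum_cmult_right[OF this, of "1 / real (Suc m) ^ q"] show ?thesis by simp
  qed
  ultimately show ?thesis
    unfolding euler_sum_def by (rule has_sum_iterated(2))
qed

lemma has_sum_prod_swap: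
  assumes "(f has_sum S) (UNIV \<times> UNIV)"
  shows "((\<lambda>(m, k). f (k, m)) has_sum S) (UNIV \<times> UNIV)"
  using assms
  by (subst has_sum_reindex_bij_witness[where T = "UNIV \<times> UNIV" and h = f and s' = S
        and j = prod.swap and i = prod.swap]) auto

text \<open>The geometric sum over p = 1, ..., q is (1/x^q - 1/(x + y)^q) / y. The term p = 1, not
  summable over pairs by itself, is moved to the right, where it is paired with 1 / (x^q y).\<close>

lemma geometric_partial_fraction:
  fixes x y :: real
  assumes "x > 0" "y > 0" "q \<ge> 1"
  shows "(\<Sum>p=2..q. 1 / ((x + y) ^ p * x ^ (q + 1 - p)))
         = 1 / x ^ q * (1 / y - 1 / (x + y)) - 1 / ((x + y) ^ q * y)"
  using assms(3)
proof (induction q rule: dec_induct)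
  case base
  show ?case using assms by (simp add: field_simps)
next
  case (step q)
  have "(\<Sum>p=2..Suc q. 1 / ((x + y) ^ p * x ^ (Suc q + 1 - p)))
        = (\<Sum>p=2..q. 1 / ((x + y) ^ p * x ^ (q + 1 - p))) / x + 1 / ((x + y) ^ Suc q * x)"
  proof -
    have "(\<Sum>p=2..q. 1 / ((x + y) ^ p * x ^ (Suc q + 1 - p)))
          = (\<Sum>p=2..q. 1 / ((x + y) ^ p * x ^ (q + 1 - p))) / x"
      unfolding sum_divide_distrib by (rule sum.cong) (auto simp: Suc_diff_le)
    then show ?thesis using step by simp
  qed
  also have "\<dots> = 1 / x ^ Suc q * (1 / y - 1 / (x + y)) - 1 / ((x + y) ^ Suc q * y)"
  proof -
    have xy: "x + y \<noteq> 0" using assms by simp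
    define X Z where "X = x ^ q" and "Z = (x + y) ^ q"
    have "X > 0" "Z > 0" using assms by (auto simp: X_def Z_def)
    then show ?thesis unfolding step.IH power_Suc X_def[symmetric] Z_def[symmetric] using assms xy
      by (simp add: divide_simps) (simp add: algebra_simps)
  qed
  finally show ?case .
qed

text \<open>Two facts on double zeta values of weight q + 1 are combined: the geometric identity
  summed over all pairs says that they add up to \<zeta>(q + 1), and reflecting p to q + 1 - p
  yields products of zeta values.\<close>

lemma euler_sum_1:
  assumes "q \<ge> 3"
  shows "2 * euler_sum 1 q = real (q + 2) * zeta (real (q + 1))
           - (\<Sum>i=1..q - 2. zeta (real (i + 1)) * zeta (real (q - i)))"
proof -
  define T where "T p = euler_sum (q + 1 - p) p - zeta (real (q + 1))" for p
  let ?Z = "zeta (real (q + 1))"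
  have T: "(dz_term p (q + 1 - p) has_sum T p) (UNIV \<times> UNIV)" if "p \<in> {2..q}" for p
  proof -
    have "1 \<le> q + 1 - p" "p + (q + 1 - p) = q + 1" using that by auto
    then show ?thesis
      using dz_term_has_sum_swap[of p "q + 1 - p"] that assms by (simp add: T_def)
  qed
  have "((\<lambda>x. \<Sum>p=2..q. dz_term p (q + 1 - p) x) has_sum (\<Sum>p=2..q. T p)) (UNIV \<times> UNIV)"
    by (intro has_sum_finite_sum T)
  \<comment> \<open>The same total from the geometric identity; its last term 1 / ((x + y)^q y) is
    \<open>dz_term q 1\<close> with x and y exchanged.\<close>
  moreover have "((\<lambda>x. \<Sum>p=2..q. dz_term p (q + 1 - p) x) has_sum euler_sum 1 q - T q) (UNIV \<times> UNIV)"
  proof -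
    have "(dz_term q 1 has_sum T q) (UNIV \<times> UNIV)" using T[of q] assms by simp
    from has_sum_diff[OF harmonic_tail_has_sum[OF assms] has_sum_prod_swap[OF this]]
    show ?thesis
    proof (rule has_sum_cong[THEN iffD1, rotated])
      fix x :: "nat \<times> nat"
      obtain m k where "x = (m, k)" by fastforce
      then show "(case x of (m, k) \<Rightarrow> 1 / real (Suc m) ^ q * (1 / real (Suc k) - 1 / (real (Suc m) + real (Suc k))))
            - (case x of (m, k) \<Rightarrow> dz_term q 1 (k, m)) = (\<Sum>p=2..q. dz_term p (q + 1 - p) x)"
        using geometric_partial_fraction[of "real (Suc m)" "real (Suc k)" q] assms
        by (simp add: dz_term_def add.commute)
    qed
  qed
  ultimately have "(\<Sum>p=2..q. T p) = euler_sum 1 q - T q"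
    by (rule has_sum_unique)
  moreover have "{2..q} = insert q {2..q - 1}" using assms by auto
  ultimately have sum_T: "(\<Sum>p=2..q - 1. T p) = 2 * ?Z - euler_sum 1 q"
    using assms by (simp add: T_def)
  have refl: "(\<Sum>p=2..q - 1. T (q + 1 - p)) = (\<Sum>p=2..q - 1. T p)"
    by (rule sum.reindex_bij_witness[of _ "\<lambda>p. q + 1 - p" "\<lambda>p. q + 1 - p"]) auto
  \<comment> \<open>Equating the two orders of summation of one double series gives this; both
    exponents are at least 2 in this range.\<close>
  have "T p + T (q + 1 - p) = zeta (real p) * zeta (real (q + 1 - p)) - ?Z" if "p \<in> {2..q - 1}" for p
  proof -
    have "T p = zeta (real p) * zeta (real (q + 1 - p)) - euler_sum p (q + 1 - p)"
      by (rule has_sum_unique[OF T dz_term_has_sum_product]) (use that in auto)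
    moreover have "p \<le> q + 1" using that by auto
    ultimately show ?thesis by (simp add: T_def)
  qed
  then have "(\<Sum>p=2..q - 1. T p + T (q + 1 - p))
             = (\<Sum>p=2..q - 1. zeta (real p) * zeta (real (q + 1 - p)) - ?Z)"
    by (intro sum.cong) auto
  also have "\<dots> = (\<Sum>p=2..q - 1. zeta (real p) * zeta (real (q + 1 - p))) - real (q - 2) * ?Z"
    using assms by (simp add: sum_subtractf Suc_diff_le numeral_2_eq_2)
  also have "(\<Sum>p=2..q - 1. zeta (real p) * zeta (real (q + 1 - p)))
             = (\<Sum>i=1..q - 2. zeta (real (i + 1)) * zeta (real (q - i)))"
    by (rule sum.reindex_bij_witness[of _ "\<lambda>i. i + 1" "\<lambda>p. p - 1"]) auto
  finally show ?thesis
    using sum_T refl assms unfolding of_nat_add[of q 2]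
    by (simp add: sum.distrib of_nat_diff algebra_simps)
qed

section \<open>Partial fractions and the weights\<close>

text \<open>The part with powers of z in the expansion of 1 / (z^a w^b), where x = z + w; the part
  with powers of w is the same expression with a and b exchanged.\<close>

definition pf_sum :: "'a :: field \<Rightarrow> 'a \<Rightarrow> nat \<Rightarrow> nat \<Rightarrow> 'a" where
  "pf_sum z x a b = (\<Sum>i<a. of_nat ((b + i - 1) choose i) / (z ^ (a - i) * x ^ (b + i)))"

text \<open>Pascal's rule, with the term i = 0 split off. It mirrors the recursion for 1 / (z^a w^b)
  that comes from 1 / (z w) = (1/z + 1/w) / (z + w).\<close>

lemma pf_sum_Suc_Suc:
  assumes "x \<noteq> 0" "z \<noteq> 0"
  shows "pf_sum z x (Suc a) (Suc b) = (pf_sum z x a (Suc b) + pf_sum z x (Suc a) b) / x"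
proof -
  have "pf_sum z x (Suc a) (Suc b)
        = 1 / (z ^ Suc a * x ^ Suc b)
          + (\<Sum>i<a. of_nat (Suc (b + i) choose Suc i) / (z ^ (a - i) * x ^ (b + i + 2)))"
    by (simp add: pf_sum_def sum.lessThan_Suc_shift of_nat_Suc del: binomial_Suc_Suc sum.lessThan_Suc)
  also have "(\<Sum>i<a. of_nat (Suc (b + i) choose Suc i) / (z ^ (a - i) * x ^ (b + i + 2)))
             = (\<Sum>i<a. of_nat (b + i choose i) / (z ^ (a - i) * x ^ (Suc b + i))) / x
               + (\<Sum>i<a. of_nat (b + i choose Suc i) / (z ^ (a - i) * x ^ (b + Suc i))) / x"
    unfolding sum_divide_distrib sum.distrib[symmetric]
    using assms by (intro sum.cong) (simp_all add: add_divide_distrib mult_ac)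
  also have "1 / (z ^ Suc a * x ^ Suc b)
      + ((\<Sum>i<a. of_nat (b + i choose i) / (z ^ (a - i) * x ^ (Suc b + i))) / x
         + (\<Sum>i<a. of_nat (b + i choose Suc i) / (z ^ (a - i) * x ^ (b + Suc i))) / x)
      = (pf_sum z x a (Suc b) + pf_sum z x (Suc a) b) / x"
    by (simp add: pf_sum_def sum.lessThan_Suc_shift add_divide_distrib mult_ac of_nat_Suc del: binomial_Suc_Suc sum.lessThan_Suc)
  finally show ?thesis .
qed

text \<open>Both sides obey the same recursion, hence induction on a + b. A general field without
  positivity is used because w will be -y. At a = b = 0 the left side is 1 and the right side
  0.\<close>

lemma partial_fraction:
  fixes z w :: "'a :: field"
  assumes "z \<noteq> 0" "w \<noteq> 0" "z + w \<noteq> 0" "a + b > 0"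
  shows "1 / (z ^ a * w ^ b) = pf_sum z (z + w) a b + pf_sum w (z + w) b a"
  using assms(4)
proof (induction "a + b" arbitrary: a b)
  case (Suc n)
  \<comment> \<open>With b = 0 the coefficient is (i - 1) choose i, which vanishes for i > 0 and, by
    truncated subtraction, is 1 for i = 0.\<close>
  have edge: "pf_sum v u c 0 = 1 / v ^ c" if c: "c > 0" for v u :: 'a and c
  proof -
    obtain d where "c = Suc d" using c gr0_conv_Suc by blast
    then show ?thesis by (simp add: pf_sum_def sum.lessThan_Suc_shift binomial_eq_0 of_nat_Suc del: sum.lessThan_Suc)
  qed
  have none: "pf_sum v u 0 c = 0" for v u :: 'a and c by (simp add: pf_sum_def)
  show ?case
  proof (cases "a = 0 \<or> b = 0")
    case True
    then show ?thesis using Suc.prems by (auto simp: edge none)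
  next
    case False
    then obtain a' b' where ab: "a = Suc a'" "b = Suc b'" by (meson not0_implies_Suc)
    have "1 / (z ^ a * w ^ b) = (1 / (z ^ a' * w ^ b) + 1 / (z ^ a * w ^ b')) / (z + w)"
      using assms unfolding ab by (simp add: divide_simps)
    also have "1 / (z ^ a' * w ^ b) = pf_sum z (z + w) a' b + pf_sum w (z + w) b a'"
      using Suc.hyps(1)[of a' b] Suc.hyps(2) ab by auto
    also have "1 / (z ^ a * w ^ b') = pf_sum z (z + w) a b' + pf_sum w (z + w) b' a"
      using Suc.hyps(1)[of a b'] Suc.hyps(2) ab by auto
    finally show ?thesis
      using assms by (simp add: ab pf_sum_Suc_Suc add_divide_distrib add_ac)
  qed
qed simp

text \<open>The common shape of all weights in the theorem: \<open>coef s i\<close> for Euler sums,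
  \<open>coef j (t - 1)\<close> for zeta products. Division by zero makes \<open>coef 0 0\<close>
  equal to 0, not 1.\<close>

definition coef :: "nat \<Rightarrow> nat \<Rightarrow> real" where
  "coef a b = real ((a + b) choose a) * (real (2 * a + b) / real (a + b))"

lemma coef_0: "b > 0 \<Longrightarrow> coef 0 b = 1"
  by (simp add: coef_def)

text \<open>With N = a + b + 1 and M = a + 1 the fraction is 1 + M/N, and M (N choose M) = N (N - 1
  choose M - 1). As a sum of two binomial coefficients the weight matches what two partial fraction
  expansions produce.\<close>

lemma coef_Suc: "coef (Suc a) b = real (Suc (a + b) choose Suc a) + real ((a + b) choose a)"
proof -
  have "real (Suc a) * real (Suc (a + b) choose Suc a) = real (Suc (a + b)) * real ((a + b) choose a)"
    by (metis Suc_times_binomial_eq mult.commute of_nat_mult)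
  moreover have "A * ((N + M) / N) = A + B" if "M * A = N * B" "N > 0" for A B M N :: real
    using that by (simp add: field_simps)
  moreover have "real (2 * Suc a + b) = real (Suc (a + b)) + real (Suc a)" "Suc a + b = Suc (a + b)"
    by (simp_all add: of_nat_Suc)
  ultimately show ?thesis
    unfolding coef_def by (simp only: of_nat_0_less_iff zero_less_Suc)
qed

text \<open>Here t is one less than in the theorem, so that x + y has exponent \<open>Suc t\<close>.
  The last terms, i = t and j = s, are the two simple poles, with coefficients
  \<open>coef s t\<close> and -\<open>coef s t\<close>.\<close>

lemma antisymmetric_partial_fraction:
  fixes x y :: real
  assumes "x > 0" "y > 0" "s \<ge> 1" "t \<ge> 1"
  shows "(-1) ^ Suc s * (x - y) / ((x + y) ^ Suc t * (x * y) ^ Suc s)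
         = (\<Sum>i<Suc t. coef s i / ((x + y) ^ (Suc t - i) * x ^ (2 * s + 1 + i)))
           + (\<Sum>j<Suc s. (-1) ^ (s + 1 + j) * coef j t / (x ^ (s + Suc t + j) * y ^ (s + 1 - j)))"
proof -
  define z w where "z = x + y" and "w = - y"
  have nz: "z \<noteq> 0" "w \<noteq> 0" "x \<noteq> 0" "y \<noteq> 0" and x: "z + w = x"
    using assms by (auto simp: z_def w_def)
  obtain r where r: "s = Suc r" using assms by (cases s) auto
  have "(-1) ^ Suc s * (x - y) / ((x + y) ^ Suc t * (x * y) ^ Suc s)
        = (x + w) / (z ^ Suc t * w ^ Suc s * x ^ Suc s)"
  proof -
    have "w ^ Suc s = (-1) ^ Suc s * y ^ Suc s"
      unfolding w_def by (rule power_minus)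
    moreover have "(-1) ^ Suc s * ((-1) ^ Suc s :: real) = 1"
      by (simp flip: power_mult_distrib)
    ultimately show ?thesis
      using nz by (simp add: w_def z_def[symmetric] field_simps power_mult_distrib)
  qed
  \<comment> \<open>Each summand of x + w cancels one power in the denominator.\<close>
  also have "\<dots> = 1 / (z ^ Suc t * w ^ Suc s) / x ^ s + 1 / (z ^ Suc t * w ^ s) / x ^ Suc s"
    using nz by (simp add: field_simps)
  also have "\<dots> = (pf_sum z x (Suc t) (Suc s) / x ^ s + pf_sum z x (Suc t) s / x ^ Suc s)
                  + (pf_sum w x (Suc s) (Suc t) / x ^ s + pf_sum w x s (Suc t) / x ^ Suc s)"
    using nz x by (subst (1 2) partial_fraction) (auto simp: add_divide_distrib)
  \<comment> \<open>Equal i gives equal denominators here, and the binomial coefficients of s + i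
    and s + i - 1 over i add up to \<open>coef s i\<close>.\<close>
  also have "pf_sum z x (Suc t) (Suc s) / x ^ s + pf_sum z x (Suc t) s / x ^ Suc s
             = (\<Sum>i<Suc t. coef s i / (z ^ (Suc t - i) * x ^ (2 * s + 1 + i)))"
    unfolding pf_sum_def sum_divide_distrib sum.distrib[symmetric]
  proof (rule sum.cong)
    fix i
    have "coef s i = real (s + i choose i) + real (r + i choose i)"
      by (simp add: r coef_Suc binomial_symmetric[of i "r + i"] binomial_symmetric[of i "Suc (r + i)"]
               Suc_diff_le del: binomial_Suc_Suc)
    then show "real (Suc s + i - 1 choose i) / (z ^ (Suc t - i) * x ^ (Suc s + i)) / x ^ s
            + real (s + i - 1 choose i) / (z ^ (Suc t - i) * x ^ (s + i)) / x ^ Suc s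
          = coef s i / (z ^ (Suc t - i) * x ^ (2 * s + 1 + i))"
      by (simp add: add_divide_distrib power_add mult_2 mult_2_right mult_ac r)
  qed simp
  \<comment> \<open>Now the second sum is one term shorter: its term j meets term j + 1 of the
    first. The unmatched term j = 0 has coefficient 1 = \<open>coef 0 t\<close>, as t \<ge>
    1.\<close>
  also have "pf_sum w x (Suc s) (Suc t) / x ^ s + pf_sum w x s (Suc t) / x ^ Suc s
             = (\<Sum>j<Suc s. coef j t / (w ^ (s + 1 - j) * x ^ (s + Suc t + j)))"
  proof -
    have "(\<Sum>j<s. real (t + Suc j choose Suc j) / (w ^ (s - j) * x ^ (Suc t + Suc j)) / x ^ s)
            + (\<Sum>j<s. real (t + j choose j) / (w ^ (s - j) * x ^ (Suc t + j)) / x ^ Suc s)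
          = (\<Sum>j<s. coef (Suc j) t / (w ^ (s - j) * x ^ (s + Suc t + Suc j)))"
      unfolding sum.distrib[symmetric]
      by (intro sum.cong)
         (auto simp: coef_Suc add_divide_distrib power_add mult_ac add_ac simp del: binomial_Suc_Suc)
    then show ?thesis
      using assms unfolding pf_sum_def sum_divide_distrib
      by (simp add: sum.lessThan_Suc_shift coef_0 power_add mult_ac
          del: binomial_Suc_Suc sum.lessThan_Suc)
  qed
  also have "\<dots> = (\<Sum>j<Suc s. (-1) ^ (s + 1 + j) * coef j t / (x ^ (s + Suc t + j) * y ^ (s + 1 - j)))"
  proof (rule sum.cong)
    fix j assume "j \<in> {..<Suc s}"
    then have "(-1) ^ (s + 1 - j) = ((-1) ^ (s + 1 + j) :: real)"
      by (simp add: minus_one_power_iff)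
    then have "w ^ (s + 1 - j) = (-1) ^ (s + 1 + j) * y ^ (s + 1 - j)"
      unfolding w_def by (subst power_minus) simp
    then show "coef j t / (w ^ (s + 1 - j) * x ^ (s + Suc t + j))
          = (-1) ^ (s + 1 + j) * coef j t / (x ^ (s + Suc t + j) * y ^ (s + 1 - j))"
      by (auto simp: minus_one_power_iff mult_ac)
  qed simp
  finally show ?thesis unfolding z_def .
qed

section \<open>The relation from antisymmetry\<close>

text \<open>The partial fraction identity is summed over all pairs. Exchanging x and y negates its
  left side but preserves the total, which is therefore 0.\<close>

lemma euler_sum_relation:
  assumes "s \<ge> 1" "t \<ge> 1"
  shows "(\<Sum>i<t. coef s i * (zeta (real (Suc t - i)) * zeta (real (2 * s + 1 + i))
                 - euler_sum (Suc t - i) (2 * s + 1 + i)))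
         + (\<Sum>j<s. (-1) ^ (s + 1 + j) * coef j t * (zeta (real (s + Suc t + j)) * zeta (real (s + 1 - j))))
         - coef s t * euler_sum 1 (2 * s + Suc t) = 0"
    (is "?R = 0")
proof -
  define F :: "nat \<times> nat \<Rightarrow> real" where
    "F = (\<lambda>(m, k). (-1) ^ Suc s * (real (Suc m) - real (Suc k))
            / ((real (Suc m) + real (Suc k)) ^ Suc t * (real (Suc m) * real (Suc k)) ^ Suc s))"
  have "((\<lambda>x. (\<Sum>i<t. coef s i * dz_term (Suc t - i) (2 * s + 1 + i) x)
            + (\<Sum>j<s. (-1) ^ (s + 1 + j) * coef j t *
                 (case x of (m, k) \<Rightarrow> 1 / (real (Suc m) ^ (s + Suc t + j) * real (Suc k) ^ (s + 1 - j))))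
            - coef s t * (case x of (m, k) \<Rightarrow> 1 / real (Suc m) ^ (2 * s + Suc t) *
                 (1 / real (Suc k) - 1 / (real (Suc m) + real (Suc k))))) has_sum ?R) (UNIV \<times> UNIV)"
    by (intro has_sum_diff has_sum_add has_sum_finite_sum has_sum_cmult_right
          dz_term_has_sum_product zeta_mult_has_sum harmonic_tail_has_sum) (use assms in auto)
  \<comment> \<open>Pointwise this is the partial fraction identity with the simple poles i = t and
    j = s merged into the multiple of 1/y - 1/(x + y).\<close>
  also have "?this \<longleftrightarrow> (F has_sum ?R) (UNIV \<times> UNIV)"
  proof (rule has_sum_cong)
    fix x :: "nat \<times> nat"
    obtain m k where mk: "x = (m, k)" by fastforce
    define a b where "a = real (Suc m)" and "b = real (Suc k)"
    have "a > 0" "b > 0" by (auto simp: a_def b_def)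
    then show "(\<Sum>i<t. coef s i * dz_term (Suc t - i) (2 * s + 1 + i) x)
            + (\<Sum>j<s. (-1) ^ (s + 1 + j) * coef j t *
                 (case x of (m, k) \<Rightarrow> 1 / (real (Suc m) ^ (s + Suc t + j) * real (Suc k) ^ (s + 1 - j))))
            - coef s t * (case x of (m, k) \<Rightarrow> 1 / real (Suc m) ^ (2 * s + Suc t) *
                 (1 / real (Suc k) - 1 / (real (Suc m) + real (Suc k)))) = F x"
      unfolding mk F_def prod.case a_def[symmetric] b_def[symmetric]
        antisymmetric_partial_fraction[OF \<open>a > 0\<close> \<open>b > 0\<close> assms] dz_term_def
      by (simp add: right_diff_distrib power_add mult_2 mult_2_right mult_ac
            diff_divide_distrib)
  qed
  finally have F: "(F has_sum ?R) (UNIV \<times> UNIV)" .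
  have "(\<lambda>(m, k). F (k, m)) = (\<lambda>x. - F x)"
  proof
    fix x :: "nat \<times> nat"
    obtain m k where x: "x = (m, k)" by fastforce
    show "(case x of (m, k) \<Rightarrow> F (k, m)) = - F x"
      unfolding x F_def prod.case minus_divide_left
      by (intro arg_cong2[of _ _ _ _ "(/)"]) (auto simp: algebra_simps)
  qed
  then have "((\<lambda>x. - F x) has_sum ?R) (UNIV \<times> UNIV)"
    using has_sum_prod_swap[OF F] by simp
  moreover have "((\<lambda>x. - F x) has_sum - ?R) (UNIV \<times> UNIV)"
    using F by (rule has_sum_uminusI)
  ultimately have "?R = - ?R" by (rule has_sum_unique)
  then show ?thesis by simp
qed

section \<open>The two forms of the theorem\<close>

theorem theorem5p15:
  fixes s t :: nat
  assumes "s \<ge> 1" and "t \<ge> 2"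
  shows
    "((\<Sum>i=1..t-1. real ((s + i - 1) choose s) * (real (2*s + i - 1) / real (s + i - 1))
          * euler_sum (t - i + 1) (2*s + i))
     = (\<Sum>i=1..t-1. real ((s + i - 1) choose s) * (real (2*s + i - 1) / real (s + i - 1))
          * zeta (real (t - i + 1)) * zeta (real (2*s + i)))
       + (-1) ^ (s + 1) * (\<Sum>i=0..s-1. (-1) ^ i * real ((t + i - 1) choose (t - 1))
          * (real (t + 2*i - 1) / real (t + i - 1))
          * zeta (real (s - i + 1)) * zeta (real (s + i + t)))
       + 1/2 * (real (2*s + t - 1) / real (s + t - 1)) * real ((s + t - 1) choose (t - 1))
          * (\<Sum>i=1..2*s+t-2. zeta (real (i + 1)) * zeta (real (2*s + t - i)))
       - 1/2 * (real ((2*s + t - 1) * (2*s + t + 2)) / real (s + t - 1))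
          * real ((s + t - 1) choose (t - 1)) * zeta (real (2*s + t + 1)))
    \<and>
    ((\<Sum>i=2..t. real ((s + t - i) choose s) * (real (2*s + t - i) / real (s + t - i))
          * euler_sum i (2*s + t - i + 1))
     = (-1) powi (int t - int s) * (\<Sum>i = int t - int s + 2..int t + 1.
          (-1) powi i * real (nat (2 * int t - i) choose (t - 1))
          * (real_of_int (3 * int t - 2*i + 1) / real_of_int (2 * int t - i))
          * zeta (real_of_int (int s - int t + i)) * zeta (real_of_int (int s + 2 * int t - i + 1)))
       + (\<Sum>i=2..t. real ((s + t - i) choose s) * (real (2*s + t - i) / real (s + t - i))
          * zeta (real i) * zeta (real (2*s + t - i + 1)))
       + 1/2 * (real (2*s + t - 1) / real (s + t - 1)) * real ((s + t - 1) choose (t - 1))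
          * (\<Sum>i=1..2*s+t-2. zeta (real (i + 1)) * zeta (real (2*s + t - i)))
       - 1/2 * (real ((2*s + t - 1) * (2*s + t + 2)) / real (s + t - 1))
          * real ((s + t - 1) choose (t - 1)) * zeta (real (2*s + t + 1)))"
    (is "?E \<and> ?E'")
proof
  \<comment> \<open>The relation is applied at u, since its exponent of x + y is
    \<open>Suc u\<close>.\<close>
  define u where "u = t - 1"
  have t: "t = Suc u" and u: "u \<ge> 1" using assms(2) by (auto simp: u_def)
  let ?D = "\<Sum>j=0..s-1. (-1) ^ j * real ((t + j - 1) choose (t - 1))
          * (real (t + 2*j - 1) / real (t + j - 1)) * zeta (real (s - j + 1)) * zeta (real (s + j + t))"
  let ?P = "\<Sum>i=1..2*s+t-2. zeta (real (i + 1)) * zeta (real (2*s + t - i))"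
  let ?Z = "zeta (real (2*s + t + 1))"
  have c_Suc: "real ((s + Suc i - 1) choose s) * (real (2*s + Suc i - 1) / real (s + Suc i - 1)) = coef s i" for i
    by (simp add: coef_def)
  have d: "real ((t + j - 1) choose (t - 1)) * (real (t + 2*j - 1) / real (t + j - 1)) = coef j u" for j
    using binomial_symmetric[of j "u + j"] by (simp add: coef_def t add.commute)
  have top: "real ((s + t - 1) choose (t - 1)) = real (s + u choose s)"
    using binomial_symmetric[of s "s + u"] by (simp add: t)
  have top1: "1/2 * (real (2*s + t - 1) / real (s + t - 1)) * real ((s + t - 1) choose (t - 1)) = 1/2 * coef s u"
    unfolding top coef_def by (simp add: t)
  have top2: "1/2 * (real ((2*s + t - 1) * (2*s + t + 2)) / real (s + t - 1)) * real ((s + t - 1) choose (t - 1))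
              = 1/2 * coef s u * real (2*s + t + 2)"
    unfolding top coef_def of_nat_mult by (simp add: t)
  have shift: "(\<Sum>i=1..t-1. f i) = (\<Sum>i<u. f (Suc i))" for f :: "nat \<Rightarrow> real"
    unfolding u_def by (rule sum.reindex_bij_witness[of _ Suc "\<lambda>i. i - 1"]) auto
  have D: "(-1) ^ (s + 1) * ?D
      = (\<Sum>j<s. (-1) ^ (s + 1 + j) * coef j u * (zeta (real (s + Suc u + j)) * zeta (real (s + 1 - j))))"
    unfolding sum_distrib_left
  proof (rule sum.cong)
    show "{0..s-1} = {..<s}" using assms(1) by auto
    fix j assume "j \<in> {..<s}"
    then have "s - j + 1 = s + 1 - j" "s + j + t = s + Suc u + j" by (auto simp: t)
    then show "(-1) ^ (s + 1) * ((-1) ^ j * real ((t + j - 1) choose (t - 1))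
          * (real (t + 2*j - 1) / real (t + j - 1)) * zeta (real (s - j + 1)) * zeta (real (s + j + t)))
       = (-1) ^ (s + 1 + j) * coef j u * (zeta (real (s + Suc u + j)) * zeta (real (s + 1 - j)))"
      unfolding d[symmetric] by (simp add: power_add mult_ac add_ac)
  qed
  \<comment> \<open>Euler's formula at the exponent of the linear sum in the relation; the factors
    1/2 of the statement come from here.\<close>
  have euler: "2 * euler_sum 1 (2*s + t) = real (2*s + t + 2) * ?Z - ?P"
    using euler_sum_1[of "2*s + t"] assms by simp
  show E: ?E
  proof -
    have "(\<Sum>i=1..t-1. real ((s + i - 1) choose s) * (real (2*s + i - 1) / real (s + i - 1))
          * euler_sum (t - i + 1) (2*s + i))
        = (\<Sum>i<u. coef s i * euler_sum (Suc u - i) (2*s + 1 + i))"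
      unfolding shift c_Suc by (intro sum.cong) (auto simp: t Suc_diff_le)
    moreover have "(\<Sum>i=1..t-1. real ((s + i - 1) choose s) * (real (2*s + i - 1) / real (s + i - 1))
          * zeta (real (t - i + 1)) * zeta (real (2*s + i)))
        = (\<Sum>i<u. coef s i * (zeta (real (Suc u - i)) * zeta (real (2*s + 1 + i))))"
      unfolding shift c_Suc by (intro sum.cong) (auto simp: t Suc_diff_le)
    moreover have "coef s u * euler_sum 1 (2*s + Suc u)
        = 1/2 * coef s u * real (2*s + t + 2) * ?Z - 1/2 * coef s u * ?P"
      using arg_cong[OF euler, of "\<lambda>x. 1/2 * coef s u * x"] by (simp add: t algebra_simps)
    ultimately show ?thesis
      using euler_sum_relation[OF assms(1) u]
      unfolding D top1 top2 by (simp add: right_diff_distrib sum_subtractf)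
  qed
  \<comment> \<open>The reflection of i to t + 1 - i turns the outer sums of the first form into
    those of the second.\<close>
  have rev: "(\<Sum>i=2..t. f i) = (\<Sum>i=1..t-1. f (t + 1 - i))" for f :: "nat \<Rightarrow> real"
    by (rule sum.reindex_bij_witness[of _ "\<lambda>i. t + 1 - i" "\<lambda>i. t + 1 - i"]) auto
  have L: "(\<Sum>i=2..t. real ((s + t - i) choose s) * (real (2*s + t - i) / real (s + t - i))
          * euler_sum i (2*s + t - i + 1))
      = (\<Sum>i=1..t-1. real ((s + i - 1) choose s) * (real (2*s + i - 1) / real (s + i - 1))
          * euler_sum (t - i + 1) (2*s + i))"
    unfolding rev
  proof (rule sum.cong)
    fix i assume i: "i \<in> {1..t-1}"
    then have "s + t - (t + 1 - i) = s + i - 1" "2*s + t - (t + 1 - i) = 2*s + i - 1"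
        "t + 1 - i = t - i + 1" "2*s + i - 1 + 1 = 2*s + i" by auto
    then show "real ((s + t - (t + 1 - i)) choose s) * (real (2*s + t - (t + 1 - i)) / real (s + t - (t + 1 - i)))
          * euler_sum (t + 1 - i) (2*s + t - (t + 1 - i) + 1)
        = real ((s + i - 1) choose s) * (real (2*s + i - 1) / real (s + i - 1))
          * euler_sum (t - i + 1) (2*s + i)" by simp
  qed simp
  have R: "(\<Sum>i=2..t. real ((s + t - i) choose s) * (real (2*s + t - i) / real (s + t - i))
          * zeta (real i) * zeta (real (2*s + t - i + 1)))
      = (\<Sum>i=1..t-1. real ((s + i - 1) choose s) * (real (2*s + i - 1) / real (s + i - 1))
          * zeta (real (t - i + 1)) * zeta (real (2*s + i)))"
    unfolding rev
  proof (rule sum.cong)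
    fix i assume i: "i \<in> {1..t-1}"
    then have "s + t - (t + 1 - i) = s + i - 1" "2*s + t - (t + 1 - i) = 2*s + i - 1"
        "t + 1 - i = t - i + 1" "2*s + i - 1 + 1 = 2*s + i" by auto
    then show "real ((s + t - (t + 1 - i)) choose s) * (real (2*s + t - (t + 1 - i)) / real (s + t - (t + 1 - i)))
          * zeta (real (t + 1 - i)) * zeta (real (2*s + t - (t + 1 - i) + 1))
        = real ((s + i - 1) choose s) * (real (2*s + i - 1) / real (s + i - 1))
          * zeta (real (t - i + 1)) * zeta (real (2*s + i))" by simp
  qed simp
  \<comment> \<open>Here i = t + 1 - j. The index is an integer because its lower limit is negative
    for s > t + 2; the signs agree since (t - s) + (t + 1 - j) has the parity of s + 1 + j.\<close>
  have M: "(-1) powi (int t - int s) * (\<Sum>i = int t - int s + 2..int t + 1.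
          (-1) powi i * real (nat (2 * int t - i) choose (t - 1))
          * (real_of_int (3 * int t - 2*i + 1) / real_of_int (2 * int t - i))
          * zeta (real_of_int (int s - int t + i)) * zeta (real_of_int (int s + 2 * int t - i + 1)))
      = (-1) ^ (s + 1) * ?D"
    unfolding sum_distrib_left
  proof (rule sum.reindex_bij_witness[of _ "\<lambda>j. int t + 1 - int j" "\<lambda>i. nat (int t + 1 - i)"])
    fix i assume i: "i \<in> {int t - int s + 2..int t + 1}"
    define j where "j = nat (int t + 1 - i)"
    have ij: "i = int t + 1 - int j" and "j < s" using i assms by (auto simp: j_def)
    have "nat (2 * int t - i) = t + j - 1" "3 * int t - 2*i + 1 = int (t + 2*j - 1)"
      "2 * int t - i = int (t + j - 1)" "int s - int t + i = int (s - j + 1)"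
      "int s + 2 * int t - i + 1 = int (s + j + t)"
      using ij \<open>j < s\<close> assms by auto
    moreover have "(-1 :: real) powi (int t - int s) * (-1) powi i = (-1) ^ (s + 1) * (-1) ^ j"
      unfolding ij by (auto simp: power_int_minus_left minus_one_power_iff)
    ultimately show "(-1) ^ (s + 1) * ((-1) ^ nat (int t + 1 - i) * real ((t + nat (int t + 1 - i) - 1) choose (t - 1))
          * (real (t + 2 * nat (int t + 1 - i) - 1) / real (t + nat (int t + 1 - i) - 1))
          * zeta (real (s - nat (int t + 1 - i) + 1)) * zeta (real (s + nat (int t + 1 - i) + t)))
        = (-1) powi (int t - int s) * ((-1) powi i * real (nat (2 * int t - i) choose (t - 1))
          * (real_of_int (3 * int t - 2*i + 1) / real_of_int (2 * int t - i))
          * zeta (real_of_int (int s - int t + i)) * zeta (real_of_int (int s + 2 * int t - i + 1)))"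
      unfolding j_def[symmetric] by (simp only: of_int_of_nat_eq mult.assoc[symmetric])
  qed (use assms in auto)
  show ?E'
    unfolding L M R using E by simp
qed

end
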